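(* Let $A, B \in \mathbb{P}$. Then: (1) The map $X \mapsto A \natural_{t} X$ is a bijection on $\mathbb{P}$ for any $t \in (0,1]$. (2) The map $X \mapsto X \natural_{t} B$ is a bijection on $\mathbb{P}$ for any $t \in [0,1)$.
   Context: $\mathcal{H}$ is a Hilbert space, $B(\mathcal{H})$ is the space of bounded linear operators on $\mathcal{H}$, and $\mathbb{P} \subset B(\mathcal{H})$ is the open convex cone of positive definite (that is, self-adjoint, positive and invertible) operators. For $A, B \in \mathbb{P}$ the geometric mean is $A \# B := A^{1/2} (A^{-1/2} B A^{-1/2})^{1/2} A^{1/2}$. For $t \in [0,1]$ the weighted spectral geometric mean is $A \natural_{t} B := (A^{-1} \# B)^{t} A (A^{-1} \# B)^{t}$. Real powers of positive definite operators are taken by functional calculus. *)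

theory Defs
  imports "HOL-Analysis.Analysis" "HOL-Computational_Algebra.Polynomial"
begin

(* A complex Hilbert space. The inner product is linear in the second argument. Since the norm is
   positive definite, the axiom cinner_self yields positive definiteness of the inner product,
   and says that the norm is the one induced by it; completeness comes from the class banach. *)

class complex_hilbert_space = banach +
  fixes scaleC :: "complex \<Rightarrow> 'a \<Rightarrow> 'a"  (infixr \<open>*\<^sub>C\<close> 75)
    and cinner :: "'a \<Rightarrow> 'a \<Rightarrow> complex"
  assumes scaleC_add_right: "c *\<^sub>C (x + y) = c *\<^sub>C x + c *\<^sub>C y"
    and scaleC_add_left: "(c + d) *\<^sub>C x = c *\<^sub>C x + d *\<^sub>C x"
    and scaleC_scaleC: "c *\<^sub>C (d *\<^sub>C x) = (c * d) *\<^sub>C x"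
    and scaleR_scaleC: "r *\<^sub>R x = complex_of_real r *\<^sub>C x"
    and cinner_commute: "cinner x y = cnj (cinner y x)"
    and cinner_add_right: "cinner x (y + z) = cinner x y + cinner x z"
    and cinner_scaleC_right: "cinner x (c *\<^sub>C y) = c * cinner x y"
    and cinner_self: "cinner x x = complex_of_real ((norm x)\<^sup>2)"

instantiation complex :: complex_hilbert_space
begin

definition scaleC_complex :: "complex \<Rightarrow> complex \<Rightarrow> complex"
  where "scaleC_complex c x = c * x"

definition cinner_complex :: "complex \<Rightarrow> complex \<Rightarrow> complex"
  where "cinner_complex x y = cnj x * y"

instance
proof
  fix x :: complex
  show "cinner x x = complex_of_real ((norm x)\<^sup>2)"
    using complex_norm_square[of x] by (simp add: cinner_complex_def mult.commute)
qed (simp_all add: scaleC_complex_def cinner_complex_def algebra_simps scaleR_conv_of_real)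

end

(* The type of bounded linear maps of the library consists of the real-linear ones;
   the elements of B(H) are those which are complex-linear. *)

definition bounded_ops :: "('a::complex_hilbert_space \<Rightarrow>\<^sub>L 'a) set"
  where "bounded_ops = {T. \<forall>c x. blinfun_apply T (c *\<^sub>C x) = c *\<^sub>C blinfun_apply T x}"

definition scalar_op :: "complex \<Rightarrow> ('a::complex_hilbert_space \<Rightarrow>\<^sub>L 'a)"
  where "scalar_op c = Blinfun (\<lambda>x. c *\<^sub>C x)"

lemma norm_scaleC: "norm (c *\<^sub>C x) = cmod c * norm (x :: 'a::complex_hilbert_space)"
proof -
  have "cinner (c *\<^sub>C x) (c *\<^sub>C x) = c * cnj (cinner x (c *\<^sub>C x))"
    using cinner_commute[of "c *\<^sub>C x" x] by (simp add: cinner_scaleC_right)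
  also have "\<dots> = complex_of_real ((cmod c * norm x)\<^sup>2)"
    using complex_norm_square[of c]
    by (simp add: cinner_scaleC_right cinner_self power_mult_distrib)
  finally have "(norm (c *\<^sub>C x))\<^sup>2 = (cmod c * norm x)\<^sup>2"
    by (metis cinner_self of_real_eq_iff)
  then show ?thesis
    by (simp add: power2_eq_iff_nonneg)
qed

lemma bounded_linear_scaleC: "bounded_linear (\<lambda>x :: 'a::complex_hilbert_space. c *\<^sub>C x)"
proof (rule bounded_linear_intro)
  show "norm (c *\<^sub>C x) \<le> norm x * cmod c" for x :: 'a
    by (simp add: norm_scaleC)
qed (simp_all add: scaleC_add_right scaleR_scaleC scaleC_scaleC mult.commute)

lemma scalar_op_apply: "blinfun_apply (scalar_op c) x = c *\<^sub>C x"
  by (simp add: scalar_op_def bounded_linear_Blinfun_apply[OF bounded_linear_scaleC])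

definition is_inverse_op ::
    "('a::complex_hilbert_space \<Rightarrow>\<^sub>L 'a) \<Rightarrow> ('a \<Rightarrow>\<^sub>L 'a) \<Rightarrow> bool"
  where "is_inverse_op T S \<longleftrightarrow>
    S \<in> bounded_ops \<and> S o\<^sub>L T = id_blinfun \<and> T o\<^sub>L S = id_blinfun"

definition invertible_op :: "('a::complex_hilbert_space \<Rightarrow>\<^sub>L 'a) \<Rightarrow> bool"
  where "invertible_op T \<longleftrightarrow> (\<exists>S. is_inverse_op T S)"

definition inv_op :: "('a::complex_hilbert_space \<Rightarrow>\<^sub>L 'a) \<Rightarrow> ('a \<Rightarrow>\<^sub>L 'a)"
  where "inv_op T = (THE S. is_inverse_op T S)"

definition self_adjoint :: "('a::complex_hilbert_space \<Rightarrow>\<^sub>L 'a) \<Rightarrow> bool"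
  where "self_adjoint T \<longleftrightarrow>
    (\<forall>x y. cinner (blinfun_apply T x) y = cinner x (blinfun_apply T y))"

definition positive_op :: "('a::complex_hilbert_space \<Rightarrow>\<^sub>L 'a) \<Rightarrow> bool"
  where "positive_op T \<longleftrightarrow> (\<forall>x. cinner x (blinfun_apply T x) \<in> \<real>\<^sub>\<ge>\<^sub>0)"

definition posdef_ops :: "('a::complex_hilbert_space \<Rightarrow>\<^sub>L 'a) set"
  where "posdef_ops = {T \<in> bounded_ops. self_adjoint T \<and> positive_op T \<and> invertible_op T}"

definition spectrum_op :: "('a::complex_hilbert_space \<Rightarrow>\<^sub>L 'a) \<Rightarrow> complex set"
  where "spectrum_op T = {c. \<not> invertible_op (T - scalar_op c)}"

definition poly_op ::
    "real poly \<Rightarrow> ('a::complex_hilbert_space \<Rightarrow>\<^sub>L 'a) \<Rightarrow> ('a \<Rightarrow>\<^sub>L 'a)"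
  where "poly_op p T =
    (\<Sum>i\<le>degree p. coeff p i *\<^sub>R ((\<lambda>S. T o\<^sub>L S) ^^ i) id_blinfun)"

(* Continuous functional calculus of a self-adjoint T: f(T) is the limit in operator norm of p_n(T)
   for polynomials p_n that converge to f uniformly on the spectrum of T. The spectrum is a
   compact set of real numbers, so for f real-valued and continuous on it such p_n with real
   coefficients exist by the Weierstrass theorem, and the limit does not depend on their choice.
   Nothing is claimed of the value for other f or T. *)

definition fun_calc ::
    "(real \<Rightarrow> real) \<Rightarrow> ('a::complex_hilbert_space \<Rightarrow>\<^sub>L 'a) \<Rightarrow> ('a \<Rightarrow>\<^sub>L 'a)"
  where "fun_calc f T = (THE S. \<forall>p :: nat \<Rightarrow> real poly.
    uniform_limit {x. complex_of_real x \<in> spectrum_op T} (\<lambda>n x. poly (p n) x) f sequentially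
      \<longrightarrow> (\<lambda>n. poly_op (p n) T) \<longlonglongrightarrow> S)"

(* For T positive definite the spectrum lies in the open positive half-line, where powr is
   continuous. *)

definition powr_op ::
    "('a::complex_hilbert_space \<Rightarrow>\<^sub>L 'a) \<Rightarrow> real \<Rightarrow> ('a \<Rightarrow>\<^sub>L 'a)"
  where "powr_op T t = fun_calc (\<lambda>x. x powr t) T"

definition geom_mean ::
    "('a::complex_hilbert_space \<Rightarrow>\<^sub>L 'a) \<Rightarrow> ('a \<Rightarrow>\<^sub>L 'a) \<Rightarrow> ('a \<Rightarrow>\<^sub>L 'a)"
  where "geom_mean A B =
    powr_op A (1/2) o\<^sub>L
      powr_op (powr_op A (-1/2) o\<^sub>L B o\<^sub>L powr_op A (-1/2)) (1/2) o\<^sub>L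
    powr_op A (1/2)"

definition spectral_geom_mean ::
    "real \<Rightarrow> ('a::complex_hilbert_space \<Rightarrow>\<^sub>L 'a) \<Rightarrow> ('a \<Rightarrow>\<^sub>L 'a) \<Rightarrow> ('a \<Rightarrow>\<^sub>L 'a)"
  where "spectral_geom_mean t A B =
    powr_op (geom_mean (inv_op A) B) t o\<^sub>L A o\<^sub>L powr_op (geom_mean (inv_op A) B) t"

end

(* Y = A^(-1) # X is the unique positive definite solution of the Riccati equation Y A Y = X.
   Hence A \<natural>_t X = Y^t A Y^t arises from X by the bijections X |-> Y, Y |-> Y^t and
   Z |-> Z A Z of the positive definite cone. For (2), Y = X^(-1) # B gives X = Y^(-1) B Y^(-1), so
   X \<natural>_t B = Y^(t-1) B Y^(t-1), again a composition of such bijections.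
   The power laws used here come from the continuous functional calculus, which rests on the bound
   ||p(T)|| \<le> sup |p| over the spectrum: S = p(T) has ||S|| or -||S|| as an approximate eigenvalue,
   so (p^2 - ||S||^2)(T) is singular, and a real polynomial q with q(T) singular has a root in the
   spectrum of T, because its non-real factors (x - a)^2 + b^2 give invertible operators. *)

theory Submission
  imports Defs "HOL-Computational_Algebra.Fundamental_Theorem_Algebra"
begin

section \<open>Inner product and self-adjoint operators\<close>

lemma cinner_add_left: "cinner (x + y) z = cinner x z + cinner (y :: 'a::complex_hilbert_space) z"
  by (metis cinner_add_right cinner_commute complex_cnj_add)

lemma cinner_scaleC_left: "cinner (c *\<^sub>C x) y = cnj c * cinner (x :: 'a::complex_hilbert_space) y"
  by (metis cinner_commute cinner_scaleC_right complex_cnj_mult)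

lemma cinner_scaleR_left: "cinner (r *\<^sub>R x) y = of_real r * cinner (x :: 'a::complex_hilbert_space) y"
  by (simp add: scaleR_scaleC cinner_scaleC_left)

lemma cinner_scaleR_right: "cinner x (r *\<^sub>R y) = of_real r * cinner x (y :: 'a::complex_hilbert_space)"
  by (simp add: scaleR_scaleC cinner_scaleC_right)

lemma norm_add_squared:
  "(norm (x + y :: 'a::complex_hilbert_space))\<^sup>2 = (norm x)\<^sup>2 + 2 * Re (cinner x y) + (norm y)\<^sup>2"
proof -
  have self: "(norm z)\<^sup>2 = Re (cinner z z)" for z :: 'a
    by (simp add: cinner_self)
  have "Re (cinner y x) = Re (cinner x y)"
    by (subst cinner_commute) simp
  then show ?thesis
    by (simp add: self cinner_add_left cinner_add_right)
qed

text \<open>Polarization writes the real part of the inner product through norms, and norms are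
  continuous. The imaginary part is the real part after multiplying the first argument by
  \<open>\<i>\<close>, because the inner product is conjugate-linear there.\<close>

lemma tendsto_cinner:
  fixes f g :: "'b \<Rightarrow> 'a::complex_hilbert_space"
  assumes "(f \<longlongrightarrow> a) F" and "(g \<longlongrightarrow> b) F"
  shows "((\<lambda>n. cinner (f n) (g n)) \<longlongrightarrow> cinner a b) F"
proof -
  have Re_eq: "Re (cinner x y) = ((norm (x + y))\<^sup>2 - (norm x)\<^sup>2 - (norm y)\<^sup>2) / 2" for x y :: 'a
    using norm_add_squared[of x y] by simp
  have Re_lim: "((\<lambda>n. Re (cinner (h n) (g n))) \<longlongrightarrow> Re (cinner c b)) F" if "(h \<longlongrightarrow> c) F" for h c
    unfolding Re_eq by (intro tendsto_intros that assms) simp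
  have "((\<lambda>n. \<i> *\<^sub>C f n) \<longlongrightarrow> \<i> *\<^sub>C a) F"
    using bounded_linear.tendsto[OF bounded_linear_scaleC assms(1)] .
  from Re_lim[OF this] have "((\<lambda>n. Im (cinner (f n) (g n))) \<longlongrightarrow> Im (cinner a b)) F"
    by (simp add: cinner_scaleC_left)
  with Re_lim[OF assms(1)] show ?thesis
    by (simp add: tendsto_complex_iff)
qed

section \<open>Algebra of operators and the class of self-adjoint operators\<close>

lemma compose_assoc: "(R o\<^sub>L S) o\<^sub>L T = R o\<^sub>L (S o\<^sub>L T)"
  by (rule blinfun_eqI) simp

lemma compose_id [simp]: "id_blinfun o\<^sub>L T = T" "T o\<^sub>L id_blinfun = T"
  by (rule blinfun_eqI, simp)+

lemmas compose_bilinear = bounded_bilinear.add_left[OF bounded_bilinear_blinfun_compose]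
  bounded_bilinear.add_right[OF bounded_bilinear_blinfun_compose]
  bounded_bilinear.diff_left[OF bounded_bilinear_blinfun_compose]
  bounded_bilinear.diff_right[OF bounded_bilinear_blinfun_compose]
  bounded_bilinear.scaleR_left[OF bounded_bilinear_blinfun_compose]
  bounded_bilinear.scaleR_right[OF bounded_bilinear_blinfun_compose]

text \<open>The class in which the functional calculus lives: it is closed under real linear
  combinations, products of commuting members and norm limits.\<close>

definition hermitian_ops :: "('a::complex_hilbert_space \<Rightarrow>\<^sub>L 'a) set"
  where "hermitian_ops = {T \<in> bounded_ops. self_adjoint T}"

lemma hermitian_apply:
  "T \<in> hermitian_ops \<Longrightarrow> cinner (blinfun_apply T x) y = cinner x (blinfun_apply T y)"
  by (simp add: hermitian_ops_def self_adjoint_def)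

lemma bounded_ops_compose: "S \<in> bounded_ops \<Longrightarrow> T \<in> bounded_ops \<Longrightarrow> S o\<^sub>L T \<in> bounded_ops"
  by (simp add: bounded_ops_def)

lemma hermitian_id: "id_blinfun \<in> hermitian_ops"
  by (simp add: hermitian_ops_def bounded_ops_def self_adjoint_def)

lemma hermitian_add: "S \<in> hermitian_ops \<Longrightarrow> T \<in> hermitian_ops \<Longrightarrow> S + T \<in> hermitian_ops"
  by (simp add: hermitian_ops_def bounded_ops_def self_adjoint_def blinfun.add_left
      scaleC_add_right cinner_add_left cinner_add_right)

lemma hermitian_scaleR: "T \<in> hermitian_ops \<Longrightarrow> r *\<^sub>R T \<in> hermitian_ops"
  by (simp add: hermitian_ops_def bounded_ops_def self_adjoint_def blinfun.scaleR_left
      cinner_scaleR_left cinner_scaleR_right)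
    (simp add: scaleR_scaleC scaleC_scaleC mult.commute)

lemma hermitian_compose_commute:
  assumes "S \<in> hermitian_ops" "T \<in> hermitian_ops" "S o\<^sub>L T = T o\<^sub>L S"
  shows "S o\<^sub>L T \<in> hermitian_ops"
proof -
  have "cinner (S (T x)) y = cinner x (S (T y))" for x y
  proof -
    have "cinner (S (T x)) y = cinner x (T (S y))"
      using assms(1,2) by (simp add: hermitian_apply)
    also have "T (S y) = S (T y)"
      using assms(3) by (metis blinfun_apply_blinfun_compose)
    finally show ?thesis .
  qed
  then show ?thesis
    using assms by (simp add: hermitian_ops_def bounded_ops_compose self_adjoint_def)
qed

lemma hermitian_congruence:
  assumes "S \<in> hermitian_ops" "T \<in> hermitian_ops"
  shows "S o\<^sub>L T o\<^sub>L S \<in> hermitian_ops"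
  using assms hermitian_apply[OF assms(1)] hermitian_apply[OF assms(2)]
  by (simp add: hermitian_ops_def bounded_ops_compose self_adjoint_def)

text \<open>Complex linearity and symmetry are identities between continuous expressions in the
  values of the operator, and norm convergence implies pointwise convergence, so both survive the
  limit.\<close>

lemma hermitian_limit:
  assumes "\<And>n. S n \<in> hermitian_ops" "S \<longlonglongrightarrow> T"
  shows "T \<in> hermitian_ops"
proof -
  have lim: "(\<lambda>n. blinfun_apply (S n) x) \<longlonglongrightarrow> blinfun_apply T x" for x
    by (intro tendsto_intros assms(2))
  have "T (c *\<^sub>C x) = c *\<^sub>C T x" for c x
  proof -
    have "(\<lambda>n. S n (c *\<^sub>C x)) \<longlonglongrightarrow> c *\<^sub>C T x"
      using bounded_linear.tendsto[OF bounded_linear_scaleC lim[of x]] assms(1)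
      by (simp add: hermitian_ops_def bounded_ops_def)
    then show ?thesis
      using lim LIMSEQ_unique by blast
  qed
  moreover have "cinner (T x) y = cinner x (T y)" for x y
  proof -
    have "(\<lambda>n. cinner (S n x) y) \<longlonglongrightarrow> cinner (T x) y" "(\<lambda>n. cinner x (S n y)) \<longlonglongrightarrow> cinner x (T y)"
      by (intro tendsto_cinner lim tendsto_const)+
    then show ?thesis
      using assms(1) by (simp add: hermitian_apply LIMSEQ_unique)
  qed
  ultimately show ?thesis
    by (simp add: hermitian_ops_def bounded_ops_def self_adjoint_def)
qed

section \<open>Invertibility\<close>

lemma inv_op_eqI:
  assumes "is_inverse_op T S"
  shows "inv_op T = S"
  unfolding inv_op_def
proof (rule the_equality)
  fix R assume "is_inverse_op T R"
  then have "R = R o\<^sub>L (T o\<^sub>L S)"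
    using assms by (simp add: is_inverse_op_def)
  also have "\<dots> = S"
    using \<open>is_inverse_op T R\<close> by (simp add: is_inverse_op_def flip: compose_assoc)
  finally show "R = S" .
qed (fact assms)

lemma invertible_op_compose:
  assumes "invertible_op S" "invertible_op T"
  shows "invertible_op (S o\<^sub>L T)"
proof -
  obtain S' T' where S': "is_inverse_op S S'" and T': "is_inverse_op T T'"
    using assms by (auto simp: invertible_op_def)
  have "T' o\<^sub>L S' o\<^sub>L (S o\<^sub>L T) = T' o\<^sub>L (S' o\<^sub>L S) o\<^sub>L T"
    by (simp only: compose_assoc)
  moreover have "S o\<^sub>L T o\<^sub>L (T' o\<^sub>L S') = S o\<^sub>L (T o\<^sub>L T') o\<^sub>L S'"
    by (simp only: compose_assoc)
  ultimately have "is_inverse_op (S o\<^sub>L T) (T' o\<^sub>L S')"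
    using S' T' by (simp add: is_inverse_op_def bounded_ops_compose)
  then show ?thesis
    unfolding invertible_op_def by blast
qed

lemma invertible_op_bounded_below:
  assumes "invertible_op T"
  obtains e where "e > 0" "\<And>x. e * norm x \<le> norm (blinfun_apply T x)"
proof -
  obtain S where S: "S o\<^sub>L T = id_blinfun"
    using assms by (auto simp: invertible_op_def is_inverse_op_def)
  show thesis
  proof (rule that)
    \<comment> \<open>The summand 1 keeps the denominator positive even for \<open>S = 0\<close>,
      which happens on the zero space.\<close>
    show "1 / (norm S + 1) > 0"
      by (simp add: add_nonneg_pos)
    show "1 / (norm S + 1) * norm x \<le> norm (T x)" for x
    proof -
      have "norm x = norm (S (T x))"
        using S by (metis blinfun_apply_blinfun_compose blinfun_apply_id_blinfun)
      also have "\<dots> \<le> norm S * norm (T x)"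
        by (rule norm_blinfun)
      also have "\<dots> \<le> (norm S + 1) * norm (T x)"
        by (simp add: mult_right_mono)
      finally show ?thesis
        by (simp add: divide_le_eq mult.commute add_nonneg_pos)
    qed
  qed
qed

text \<open>The lower bound gives injectivity, and applied to \<open>g x\<close> it bounds the
  set-theoretic inverse \<open>g\<close> by 1/e. Linearity of \<open>g\<close> is pulled back
  through the injective \<open>T\<close>.\<close>

lemma invertible_op_if_surj:
  assumes T: "T \<in> bounded_ops" and e: "e > 0" "\<And>x. e * norm x \<le> norm (blinfun_apply T x)"
    and surj: "surj (blinfun_apply T)"
  shows "invertible_op T"
proof -
  have inj: "x = y" if "T x = T y" for x y
    using e(2)[of "x - y"] e(1) that by (simp add: blinfun.diff_right mult_le_0_iff)
  define g where "g = inv (blinfun_apply T)"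
  have Tg: "T (g y) = y" for y
    using surj by (simp add: g_def surj_f_inv_f)
  have gT: "g (T x) = x" for x
    by (rule inj) (simp add: Tg)
  have gC: "g (c *\<^sub>C y) = c *\<^sub>C g y" for c y
    by (rule inj) (use T in \<open>simp add: Tg bounded_ops_def\<close>)
  have bl: "bounded_linear g"
  proof (rule bounded_linear_intro)
    show "g (x + y) = g x + g y" for x y
      by (rule inj) (simp add: Tg blinfun.add_right)
    show "g (r *\<^sub>R x) = r *\<^sub>R g x" for r x
      by (simp add: gC scaleR_scaleC)
    show "norm (g x) \<le> norm x * (1 / e)" for x
      using e(2)[of "g x"] e(1) by (simp add: Tg pos_le_divide_eq mult.commute)
  qed
  have "is_inverse_op T (Blinfun g)"
    unfolding is_inverse_op_def bounded_ops_def using bl gC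
    by (auto intro!: blinfun_eqI simp: bounded_linear_Blinfun_apply Tg gT)
  then show ?thesis
    by (auto simp: invertible_op_def)
qed

text \<open>For \<open>K > \<parallel>T\<parallel>\<^sup>2\<close> the map \<open>x \<mapsto> y / K + (x - T\<^sup>2 x / K)\<close> is a contraction; its fixed point solves
  \<open>T\<^sup>2 x = y\<close>.\<close>

lemma hermitian_invertible:
  assumes T: "T \<in> hermitian_ops" and e: "e > 0" "\<And>x. e * norm x \<le> norm (blinfun_apply T x)"
  shows "invertible_op T"
proof (rule invertible_op_if_surj)
  \<comment> \<open>The summand e^2 makes K positive and at least e^2, so that the contraction
    constant c below is the root of a nonnegative number less than 1.\<close>
  define K where "K = (norm T)\<^sup>2 + e\<^sup>2"
  have K: "K > 0" "e\<^sup>2 \<le> K" "(norm T)\<^sup>2 \<le> K"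
    using e(1) by (simp_all add: K_def add_nonneg_pos)
  define c where "c = sqrt (1 - e\<^sup>2 / K)"
  have c: "0 \<le> c" "c < 1"
    using K e(1) by (auto simp: c_def)
  \<comment> \<open>In the expanded square, self-adjointness turns the cross term into -2 ||T x||^2
    / K. One half of it absorbs ||T (T x)||^2 / K^2; the other half is at most -(e^2 / K)
    ||x||^2.\<close>
  have contr: "norm (x - (1 / K) *\<^sub>R T (T x)) \<le> c * norm x" for x
  proof -
    have "norm (T (T x)) \<le> norm T * norm (T x)"
      by (rule norm_blinfun)
    then have "(norm (T (T x)))\<^sup>2 \<le> (norm T)\<^sup>2 * (norm (T x))\<^sup>2"
      by (metis norm_ge_zero power_mono power_mult_distrib)
    also have "\<dots> \<le> K * (norm (T x))\<^sup>2"
      using K(3) by (intro mult_right_mono) auto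
    finally have 1: "(norm (T (T x)))\<^sup>2 / K\<^sup>2 \<le> (norm (T x))\<^sup>2 / K"
      using K(1) by (simp add: divide_simps power2_eq_square mult.commute)
    have "(e * norm x)\<^sup>2 \<le> (norm (T x))\<^sup>2"
      using e by (intro power_mono) auto
    then have 2: "e\<^sup>2 / K * (norm x)\<^sup>2 \<le> (norm (T x))\<^sup>2 / K"
      using K(1) by (simp add: divide_right_mono power_mult_distrib)
    have "cinner x (T (T x)) = of_real ((norm (T x))\<^sup>2)"
      using hermitian_apply[OF T, of x "T x"] by (simp add: cinner_self)
    then have "(norm (x + (- (1 / K)) *\<^sub>R T (T x)))\<^sup>2
        = (norm x)\<^sup>2 - 2 * ((norm (T x))\<^sup>2 / K) + (norm (T (T x)))\<^sup>2 / K\<^sup>2"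
      unfolding norm_add_squared cinner_scaleR_right
      by (simp add: power_mult_distrib power_divide)
    also have "\<dots> \<le> (1 - e\<^sup>2 / K) * (norm x)\<^sup>2"
      using 1 2 by (simp add: algebra_simps)
    also have "\<dots> = (c * norm x)\<^sup>2"
      using K by (simp add: c_def power_mult_distrib)
    finally have "(norm (x - (1 / K) *\<^sub>R T (T x)))\<^sup>2 \<le> (c * norm x)\<^sup>2"
      by simp
    then show ?thesis
      using c by (simp add: power2_le_iff_abs_le)
  qed
  have "\<exists>x. T x = y" for y
  proof -
    define F where "F x = (1 / K) *\<^sub>R y + (x - (1 / K) *\<^sub>R T (T x))" for x
    have "dist (F x) (F z) \<le> c * dist x z" for x z
      using contr[of "x - z"]
      by (simp add: F_def dist_norm blinfun.diff_right algebra_simps)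
    then obtain x where "F x = x"
      using banach_fix_type[OF c, of F] by auto
    then have "(1 / K) *\<^sub>R T (T x) = (1 / K) *\<^sub>R y"
      by (auto simp: F_def add_diff_eq diff_eq_eq)
    then have "K *\<^sub>R (1 / K) *\<^sub>R T (T x) = K *\<^sub>R (1 / K) *\<^sub>R y"
      by (rule arg_cong)
    then have "T (T x) = y"
      using K(1) by simp
    then show ?thesis
      by blast
  qed
  then show "surj (blinfun_apply T)"
    by (metis surjI)
qed (use assms in \<open>auto simp: hermitian_ops_def\<close>)

section \<open>Polynomials of a self-adjoint operator\<close>

text \<open>The added coefficients vanish. A free upper bound is wanted for
  \<open>pCons a p\<close>, whose degree is not \<open>Suc (degree p)\<close> when
  \<open>p = 0\<close>.\<close>

lemma poly_op_altdef:
  assumes "degree p \<le> n"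
  shows "poly_op p T = (\<Sum>i\<le>n. coeff p i *\<^sub>R ((\<lambda>S. T o\<^sub>L S) ^^ i) id_blinfun)"
  unfolding poly_op_def
  by (rule sum.mono_neutral_left) (use assms in \<open>auto simp: coeff_eq_0\<close>)

lemma poly_op_0 [simp]: "poly_op 0 T = 0"
  by (simp add: poly_op_def)

text \<open>Horner's rule. With it, the homomorphism laws for \<open>poly_op\<close> follow by
  induction on the polynomial.\<close>

lemma poly_op_pCons: "poly_op (pCons a p) T = a *\<^sub>R id_blinfun + (T o\<^sub>L poly_op p T)"
proof -
  have "poly_op (pCons a p) T
      = (\<Sum>i\<le>Suc (degree p). coeff (pCons a p) i *\<^sub>R ((\<lambda>S. T o\<^sub>L S) ^^ i) id_blinfun)"
    by (rule poly_op_altdef) (simp add: degree_pCons_le)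
  also have "\<dots> = a *\<^sub>R id_blinfun
      + (\<Sum>i\<le>degree p. T o\<^sub>L (coeff p i *\<^sub>R ((\<lambda>S. T o\<^sub>L S) ^^ i) id_blinfun))"
    by (simp add: sum.atMost_Suc_shift compose_bilinear del: sum.atMost_Suc)
  also have "\<dots> = a *\<^sub>R id_blinfun + (T o\<^sub>L poly_op p T)"
    by (simp add: poly_op_def bounded_bilinear.sum_right[OF bounded_bilinear_blinfun_compose])
  finally show ?thesis .
qed

lemma poly_op_add: "poly_op (p + q) T = poly_op p T + poly_op q T"
  by (induction p q rule: poly_induct2)
    (simp_all add: poly_op_pCons compose_bilinear scaleR_add_left)

lemma poly_op_smult: "poly_op (smult r p) T = r *\<^sub>R poly_op p T"
  by (induction p) (simp_all add: poly_op_pCons compose_bilinear scaleR_add_right)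

lemma poly_op_diff: "poly_op (p - q) T = poly_op p T - poly_op q T"
  using poly_op_add[of "p - q" q T] by simp

lemma poly_op_mult: "poly_op (p * q) T = poly_op p T o\<^sub>L poly_op q T"
  by (induction p)
    (simp_all add: poly_op_pCons poly_op_add poly_op_smult compose_bilinear compose_assoc)

lemma poly_op_commute: "poly_op p T o\<^sub>L poly_op q T = poly_op q T o\<^sub>L poly_op p T"
  by (metis mult.commute poly_op_mult)

lemma poly_op_linear: "poly_op [:a, 1:] T = a *\<^sub>R id_blinfun + T"
  by (simp add: poly_op_pCons)

lemma hermitian_poly_op:
  assumes "T \<in> hermitian_ops"
  shows "poly_op p T \<in> hermitian_ops"
proof (induction p)
  case 0
  show ?case
    using hermitian_scaleR[OF hermitian_id, of 0] by simp
next
  case (pCons a p)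
  have "T o\<^sub>L poly_op p T = poly_op p T o\<^sub>L T"
    using poly_op_commute[of "[:0, 1:]" T p] by (simp add: poly_op_pCons)
  then show ?case
    unfolding poly_op_pCons
    by (intro hermitian_add hermitian_scaleR hermitian_id hermitian_compose_commute assms pCons.IH)
qed

text \<open>Exactly the set on which \<open>fun_calc\<close> asks for uniform convergence, given a
  name so that its definition can be folded.\<close>

definition real_spectrum :: "('a::complex_hilbert_space \<Rightarrow>\<^sub>L 'a) \<Rightarrow> real set"
  where "real_spectrum T = {x. complex_of_real x \<in> spectrum_op T}"

lemma scalar_op_of_real: "scalar_op (complex_of_real r) = r *\<^sub>R id_blinfun"
  by (rule blinfun_eqI) (simp add: scalar_op_apply blinfun.scaleR_left scaleR_scaleC)

lemma not_in_real_spectrum_iff: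
  "c \<notin> real_spectrum T \<longleftrightarrow> invertible_op (poly_op [:- c, 1:] T)"
  by (simp add: real_spectrum_def spectrum_op_def scalar_op_of_real poly_op_linear)

lemma norm_squared_add_scaleR:
  assumes S: "S \<in> hermitian_ops"
  shows "(norm (S (S x) + r *\<^sub>R x))\<^sup>2 = (norm (S (S x)))\<^sup>2 + 2 * r * (norm (S x))\<^sup>2 + r\<^sup>2 * (norm x)\<^sup>2"
  by (simp add: norm_add_squared cinner_scaleR_right hermitian_apply[OF S] power_mult_distrib)
    (simp add: cinner_self flip: hermitian_apply[OF S])

text \<open>In the expansion of ||S (S x) + r x||^2 the cross term is 2 r ||S x||^2 by
  self-adjointness. For r > 0 no term is negative, so r is a lower bound for the operator, and a
  self-adjoint operator bounded below is invertible.\<close>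

lemma invertible_op_square_plus:
  assumes S: "S \<in> hermitian_ops" and r: "r > 0"
  shows "invertible_op ((S o\<^sub>L S) + r *\<^sub>R id_blinfun)"
proof (rule hermitian_invertible[OF _ r])
  show "(S o\<^sub>L S) + r *\<^sub>R id_blinfun \<in> hermitian_ops"
    by (intro hermitian_add hermitian_compose_commute hermitian_scaleR hermitian_id S refl)
  show "r * norm x \<le> norm (((S o\<^sub>L S) + r *\<^sub>R id_blinfun) x)" for x
  proof -
    have "(r * norm x)\<^sup>2 \<le> (norm (S (S x) + r *\<^sub>R x))\<^sup>2"
      using r by (simp add: norm_squared_add_scaleR[OF S] power_mult_distrib)
    then have "r * norm x \<le> norm (S (S x) + r *\<^sub>R x)"
      by (rule power2_le_imp_le) simp
    then show ?thesis
      by (simp add: blinfun.add_left blinfun.scaleR_left)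
  qed
qed

section \<open>Complex roots of real polynomials and invertibility of q(T)\<close>

definition complex_eval :: "real poly \<Rightarrow> complex \<Rightarrow> complex"
  where "complex_eval p z = poly (map_poly complex_of_real p) z"

lemma complex_eval_pCons [simp]: "complex_eval (pCons a p) z = of_real a + z * complex_eval p z"
  by (simp add: complex_eval_def map_poly_pCons)

lemma complex_eval_0 [simp]: "complex_eval 0 z = 0"
  by (simp add: complex_eval_def)

lemma complex_eval_add: "complex_eval (p + q) z = complex_eval p z + complex_eval q z"
  by (induction p q rule: poly_induct2) (simp_all add: algebra_simps)

lemma complex_eval_smult: "complex_eval (smult a p) z = of_real a * complex_eval p z"
  by (induction p) (simp_all add: algebra_simps)

lemma complex_eval_mult: "complex_eval (p * q) z = complex_eval p z * complex_eval q z"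
  by (induction p) (simp_all add: complex_eval_add complex_eval_smult algebra_simps)

lemma complex_eval_of_real: "complex_eval p (of_real x) = of_real (poly p x)"
  by (induction p) simp_all

text \<open>The quadratic d vanishes at z and has degree 2, so the remainder of q modulo d is a
  linear a + b x vanishing at z. Its imaginary part there is b Im z, which forces b = 0 and then a =
  0.\<close>

lemma quadratic_dvd:
  assumes z: "complex_eval q z = 0" "Im z \<noteq> 0"
  shows "[:- Re z, 1:] * [:- Re z, 1:] + [:(Im z)\<^sup>2:] dvd q"
proof -
  define d where "d = [:- Re z, 1:] * [:- Re z, 1:] + [:(Im z)\<^sup>2:]"
  have "degree (q mod d) < 2"
    using degree_mod_less'[of d q] by (cases "q mod d = 0") (auto simp: d_def)
  moreover obtain a b r where mod: "q mod d = pCons a (pCons b r)"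
    by (metis pCons_cases)
  ultimately have r: "r = 0"
    by (cases "r = 0") (auto split: if_splits)
  have "complex_eval d z = 0"
    by (simp add: d_def complex_eval_add complex_eval_mult complex_eq_iff power2_eq_square)
  then have "complex_eval (q mod d) z = 0"
    using z(1) by (metis add.left_neutral complex_eval_add complex_eval_mult div_mult_mod_eq mult_zero_right)
  then have "b = 0 \<and> a = 0"
    using z(2) by (auto simp: mod r complex_eq_iff)
  then show ?thesis
    using mod r by (simp add: mod_eq_0_iff_dvd d_def)
qed

text \<open>Induction on the degree, with a complex root z of q from the fundamental theorem of
  algebra. A real z lies outside the spectrum, so T - z is invertible; a non-real z splits off a
  quadratic factor whose value at T is a square plus a positive scalar. The cofactor has smaller
  degree.\<close>

lemma invertible_poly_op:
  assumes T: "T \<in> hermitian_ops"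
  shows "q \<noteq> 0 \<Longrightarrow> (\<And>c. c \<in> real_spectrum T \<Longrightarrow> poly q c \<noteq> 0) \<Longrightarrow> invertible_op (poly_op q T)"
proof (induction "degree q" arbitrary: q rule: less_induct)
  case less
  have step: "invertible_op (poly_op q T)"
    if d: "degree d > 0" "invertible_op (poly_op d T)" and q: "q = d * r" for d r
  proof -
    have "degree r < degree q"
      using less.prems(1) d(1) by (auto simp: q degree_mult_eq)
    then have "invertible_op (poly_op r T)"
      using less.prems by (intro less.hyps) (auto simp: q)
    then show ?thesis
      using d(2) by (simp add: q poly_op_mult invertible_op_compose)
  qed
  show ?case
  proof (cases "degree q = 0")
    case True
    then obtain a where a: "q = [:a:]"
      by (rule degree_eq_zeroE)
    with less.prems have "a \<noteq> 0"
      by simp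
    moreover have "(1 / a) *\<^sub>R id_blinfun \<in> (bounded_ops :: ('a \<Rightarrow>\<^sub>L 'a) set)"
      using hermitian_scaleR[OF hermitian_id] by (auto simp: hermitian_ops_def)
    ultimately have "is_inverse_op (poly_op q T) ((1 / a) *\<^sub>R id_blinfun)"
      by (simp add: a is_inverse_op_def poly_op_pCons compose_bilinear)
    then show ?thesis
      by (auto simp: invertible_op_def)
  next
    case False
    then have "degree (map_poly complex_of_real q) \<noteq> 0"
      by (simp add: degree_map_poly)
    then obtain z where z: "complex_eval q z = 0"
      using fundamental_theorem_of_algebra[of "map_poly complex_of_real q"]
      by (auto simp: constant_degree complex_eval_def)
    show ?thesis
    proof (cases "Im z = 0")
      case True
      then have "z = of_real (Re z)"
        by (simp add: complex_eq_iff)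
      then have root: "poly q (Re z) = 0"
        using z by (metis complex_eval_of_real of_real_eq_0_iff)
      then obtain r where r: "q = [:- Re z, 1:] * r"
        by (auto simp: poly_eq_0_iff_dvd dvd_def)
      have "invertible_op (poly_op [:- Re z, 1:] T)"
        using less.prems(2) root not_in_real_spectrum_iff[of "Re z" T] by auto
      then show ?thesis
        by (rule step[OF _ _ r, rotated]) simp
    next
      case False
      then obtain r where r: "q = ([:- Re z, 1:] * [:- Re z, 1:] + [:(Im z)\<^sup>2:]) * r"
        using quadratic_dvd[OF z] by (auto elim: dvdE)
      have "invertible_op (poly_op ([:- Re z, 1:] * [:- Re z, 1:] + [:(Im z)\<^sup>2:]) T)"
        using invertible_op_square_plus[OF hermitian_poly_op[OF T, of "[:- Re z, 1:]"], of "(Im z)\<^sup>2"] False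
        by (simp add: poly_op_add poly_op_mult poly_op_pCons del: mult_pCons_left mult_pCons_right add_pCons)
      then show ?thesis
        by (rule step[OF _ _ r, rotated]) simp
    qed
  qed
qed

section \<open>The norm of p(T) bounded by the values of p on the spectrum\<close>

text \<open>A lower bound for S^2 - ||S||^2 would improve the estimate of ||S y|| to a constant
  strictly below ||S||. The nonzero vector excludes the zero space, where every operator is
  invertible.\<close>

lemma not_invertible_square_minus:
  fixes S :: "'a::complex_hilbert_space \<Rightarrow>\<^sub>L 'a"
  assumes S: "S \<in> hermitian_ops" and x: "(x :: 'a) \<noteq> 0"
  shows "\<not> invertible_op ((S o\<^sub>L S) - (norm S)\<^sup>2 *\<^sub>R id_blinfun)"
proof
  assume "invertible_op ((S o\<^sub>L S) - (norm S)\<^sup>2 *\<^sub>R id_blinfun)"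
  then obtain e where e: "e > 0"
    "\<And>x. e * norm x \<le> norm (((S o\<^sub>L S) - (norm S)\<^sup>2 *\<^sub>R id_blinfun) x)"
    by (rule invertible_op_bounded_below) (rule that)
  define l where "l = (norm S)\<^sup>2"
  \<comment> \<open>Square the lower bound, expand, and use ||S (S x)||^2 \<le> l ||S x||^2 \<le>
    l^2 ||x||^2.\<close>
  have low: "2 * l * (norm (S x))\<^sup>2 \<le> (2 * l\<^sup>2 - e\<^sup>2) * (norm x)\<^sup>2" for x
  proof -
    have "e * norm x \<le> norm (S (S x) + (- l) *\<^sub>R x)"
      using e(2)[of x] by (simp add: blinfun.diff_left blinfun.scaleR_left l_def)
    then have "(e * norm x)\<^sup>2 \<le> (norm (S (S x) + (- l) *\<^sub>R x))\<^sup>2"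
      using e(1) by (intro power_mono) auto
    also have "\<dots> = (norm (S (S x)))\<^sup>2 - 2 * l * (norm (S x))\<^sup>2 + l\<^sup>2 * (norm x)\<^sup>2"
      unfolding norm_squared_add_scaleR[OF S] by simp
    also have "(norm (S (S x)))\<^sup>2 \<le> l * (norm (S x))\<^sup>2"
      using power_mono[OF norm_blinfun[of S "S x"], of 2] by (simp add: l_def power_mult_distrib)
    also have "l * (norm (S x))\<^sup>2 \<le> l * (l * (norm x)\<^sup>2)"
      using power_mono[OF norm_blinfun[of S x], of 2]
      by (intro mult_left_mono) (simp_all add: l_def power_mult_distrib)
    finally show ?thesis
      by (simp add: power2_eq_square algebra_simps)
  qed
  show False
  proof (cases "l = 0")
    case True
    then have "e\<^sup>2 * (norm x)\<^sup>2 \<le> 0"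
      using low[of x] by simp
    then show False
      using e(1) x by (simp add: mult_le_0_iff)
  next
    case False
    then have l: "l > 0"
      by (simp add: l_def)
    \<comment> \<open>Dividing \<open>low\<close> by 2 l gives ||S y||^2 \<le> k ||y||^2 with this
      k, which is smaller than l = ||S||^2.\<close>
    define k where "k = l - e\<^sup>2 / (2 * l)"
    have k: "k < l"
      using l e(1) by (simp add: k_def)
    have k_eq: "2 * l\<^sup>2 - e\<^sup>2 = 2 * l * k"
      using l by (simp add: k_def field_simps power2_eq_square)
    have "norm S \<le> sqrt (max 0 k)"
    proof (rule norm_blinfun_bound)
      fix y
      have "2 * l * (norm (S y))\<^sup>2 \<le> 2 * l * (k * (norm y)\<^sup>2)"
        using low[of y] by (simp only: k_eq mult.assoc)
      then have "(norm (S y))\<^sup>2 \<le> k * (norm y)\<^sup>2"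
        using l by simp
      also have "\<dots> \<le> max 0 k * (norm y)\<^sup>2"
        by (intro mult_right_mono) auto
      also have "\<dots> = (sqrt (max 0 k) * norm y)\<^sup>2"
        by (simp add: power_mult_distrib)
      finally show "norm (S y) \<le> sqrt (max 0 k) * norm y"
        by (rule power2_le_imp_le) simp
    qed simp
    then have "(norm S)\<^sup>2 \<le> (sqrt (max 0 k))\<^sup>2"
      by (intro power_mono) auto
    then show False
      using k l by (simp add: l_def max_def split: if_splits)
  qed
qed

text \<open>The operator q(T) = p(T)^2 - ||p(T)||^2 is singular. A nonzero q with q(T) singular has
  a root c in the spectrum, and q(c) = 0 is the claim squared.\<close>

lemma norm_in_real_spectrum:
  fixes T :: "'a::complex_hilbert_space \<Rightarrow>\<^sub>L 'a"
  assumes T: "T \<in> hermitian_ops" and x: "(x :: 'a) \<noteq> 0"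
    and q: "q = p\<^sup>2 - [:(norm (poly_op p T))\<^sup>2:]" "q \<noteq> 0"
  shows "\<exists>c \<in> real_spectrum T. \<bar>poly p c\<bar> = norm (poly_op p T)"
proof -
  have "poly_op q T = (poly_op p T o\<^sub>L poly_op p T) - (norm (poly_op p T))\<^sup>2 *\<^sub>R id_blinfun"
    by (simp add: q(1) poly_op_diff power2_eq_square poly_op_mult poly_op_pCons)
  then have "\<not> invertible_op (poly_op q T)"
    using not_invertible_square_minus[OF hermitian_poly_op[OF T] x] by simp
  then obtain c where c: "c \<in> real_spectrum T" "poly q c = 0"
    using invertible_poly_op[OF T q(2)] by blast
  then have "(poly p c)\<^sup>2 = (norm (poly_op p T))\<^sup>2"
    by (simp add: q(1))
  then have "\<bar>poly p c\<bar> = norm (poly_op p T)"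
    by (metis abs_norm_cancel power2_eq_iff_nonneg abs_ge_zero power2_abs norm_ge_zero)
  with c(1) show ?thesis
    by blast
qed

text \<open>On a nonzero space the norm equals |p(c)| for some spectral point c. The zero space is
  treated apart, since its spectrum is empty.\<close>

lemma norm_poly_op_le:
  fixes T :: "'a::complex_hilbert_space \<Rightarrow>\<^sub>L 'a"
  assumes T: "T \<in> hermitian_ops" and e: "0 \<le> e" "\<And>c. c \<in> real_spectrum T \<Longrightarrow> \<bar>poly p c\<bar> \<le> e"
  shows "norm (poly_op p T) \<le> e"
proof (cases "\<forall>x::'a. x = 0")
  case True
  then have "poly_op p T = 0"
    by (intro blinfun_eqI) auto
  then show ?thesis
    using e(1) by simp
next
  case False
  then obtain x :: 'a where x: "x \<noteq> 0"
    by blast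
  define q where "q = p\<^sup>2 - [:(norm (poly_op p T))\<^sup>2:]"
  have "\<exists>c \<in> real_spectrum T. \<bar>poly p c\<bar> = norm (poly_op p T)"
  proof (cases "q = 0")
    case True
    \<comment> \<open>If q = 0, every real number c satisfies |p(c)| = ||p(T)||, so any spectral
      point will do. One exists by the previous lemma applied to the polynomial x, for which the
      difference is not zero.\<close>
    have "[:0, 1:]\<^sup>2 - [:(norm (poly_op [:0, 1:] T))\<^sup>2:] \<noteq> 0"
      by (simp add: power2_eq_square)
    then obtain c where c: "c \<in> real_spectrum T"
      using norm_in_real_spectrum[OF T x refl] by blast
    have "(poly p c)\<^sup>2 = (norm (poly_op p T))\<^sup>2"
      using arg_cong[OF True, of "\<lambda>q. poly q c"] by (simp add: q_def)
    then have "\<bar>poly p c\<bar> = norm (poly_op p T)"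
      by (metis abs_ge_zero norm_ge_zero power2_abs power2_eq_iff_nonneg)
    with c show ?thesis
      by blast
  qed (use norm_in_real_spectrum[OF T x q_def] in blast)
  then show ?thesis
    using e(2) by fastforce
qed

section \<open>Continuous functional calculus\<close>

text \<open>This makes the definite description in \<open>fun_calc\<close> meaningful. By the norm
  bound, sequences of polynomials that approach f uniformly on the spectrum give Cauchy sequences of
  operators, and any two of them have the same limit.\<close>

lemma fun_calc_limit:
  assumes T: "T \<in> hermitian_ops"
    and p: "uniform_limit (real_spectrum T) (\<lambda>n. poly (p n)) f sequentially"
  shows "(\<lambda>n. poly_op (p n) T) \<longlonglongrightarrow> fun_calc f T"
proof -
  have diff: "norm (poly_op (q n) T - poly_op (r m) T) \<le> 2 * e"
    if "\<forall>x\<in>real_spectrum T. dist (poly (q n) x) (f x) < e"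
       "\<forall>x\<in>real_spectrum T. dist (poly (r m) x) (f x) < e" "0 < e"
    for q r :: "nat \<Rightarrow> real poly" and m n e
    unfolding poly_op_diff[symmetric]
  proof (rule norm_poly_op_le[OF T])
    fix c assume "c \<in> real_spectrum T"
    with that(1,2) have "dist (poly (q n) c) (f c) < e" "dist (poly (r m) c) (f c) < e"
      by auto
    then show "\<bar>poly (q n - r m) c\<bar> \<le> 2 * e"
      by (simp add: dist_real_def)
  qed (use that in simp)
  have "Cauchy (\<lambda>n. poly_op (p n) T)"
  proof (rule metric_CauchyI)
    fix e :: real assume e: "e > 0"
    then have "\<forall>\<^sub>F n in sequentially. \<forall>x\<in>real_spectrum T. dist (poly (p n) x) (f x) < e / 3"
      using uniform_limitD[OF p, of "e / 3"] by simp
    then obtain N where "\<And>n. n \<ge> N \<Longrightarrow> \<forall>x\<in>real_spectrum T. dist (poly (p n) x) (f x) < e / 3"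
      by (auto simp: eventually_sequentially)
    then have "norm (poly_op (p m) T - poly_op (p n) T) \<le> 2 * (e / 3)" if "m \<ge> N" "n \<ge> N" for m n
      using diff[of p m "e / 3" p n] that e by simp
    then have "dist (poly_op (p m) T) (poly_op (p n) T) < e" if "m \<ge> N" "n \<ge> N" for m n
      using that e unfolding dist_norm by fastforce
    then show "\<exists>N. \<forall>m\<ge>N. \<forall>n\<ge>N. dist (poly_op (p m) T) (poly_op (p n) T) < e"
      by blast
  qed
  then obtain S where S: "(\<lambda>n. poly_op (p n) T) \<longlonglongrightarrow> S"
    by (auto simp: Cauchy_convergent_iff convergent_def)
  have "(\<lambda>n. poly_op (q n) T) \<longlonglongrightarrow> S"
    if q: "uniform_limit (real_spectrum T) (\<lambda>n. poly (q n)) f sequentially" for q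
  proof -
    have "(\<lambda>n. poly_op (q n) T - poly_op (p n) T) \<longlonglongrightarrow> 0"
    proof (rule tendstoI)
      fix e :: real assume e: "e > 0"
      then have "e / 3 > 0"
        by simp
      from uniform_limitD[OF p this] uniform_limitD[OF q this]
      show "\<forall>\<^sub>F n in sequentially. dist (poly_op (q n) T - poly_op (p n) T) 0 < e"
      proof eventually_elim
        case (elim n)
        then show ?case
          using diff[of q n "e / 3" p n] e by simp
      qed
    qed
    from tendsto_add[OF this S] show ?thesis
      by simp
  qed
  \<comment> \<open>Uniqueness of the described operator uses that \<open>p\<close> itself satisfies
    the premise; without such a sequence the condition would be vacuous.\<close>
  then have "fun_calc f T = S"
    unfolding fun_calc_def real_spectrum_def[symmetric]
    using p S LIMSEQ_unique by (intro the_equality) blast+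
  with S show ?thesis
    by simp
qed

text \<open>Weierstrass approximation with error 1/(n+1), the approximating polynomial functions
  being rewritten as \<open>poly\<close> of a coefficient polynomial.\<close>

lemma uniform_limit_poly:
  fixes f :: "real \<Rightarrow> real"
  assumes "continuous_on {a..b} f"
  obtains p where "uniform_limit {a..b} (\<lambda>n. poly (p n)) f sequentially"
proof -
  have "\<exists>p. \<forall>x\<in>{a..b}. dist (poly p x) (f x) < inverse (real (Suc n))" for n
  proof -
    obtain g where g: "real_polynomial_function g"
      "\<And>x. x \<in> {a..b} \<Longrightarrow> \<bar>f x - g x\<bar> < inverse (real (Suc n))"
      using Stone_Weierstrass_real_polynomial_function[OF compact_Icc assms, of "inverse (real (Suc n))"]
      by auto
    then obtain c m where "g = (\<lambda>x. \<Sum>i\<le>m. c i * x ^ i)"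
      by (auto simp: real_polynomial_function_iff_sum)
    then have "poly (\<Sum>i\<le>m. monom (c i) i) = g"
      by (simp add: fun_eq_iff poly_sum poly_monom)
    with g(2) show ?thesis
      by (metis dist_commute dist_real_def)
  qed
  then obtain p where p: "\<And>n x. x \<in> {a..b} \<Longrightarrow> dist (poly (p n) x) (f x) < inverse (real (Suc n))"
    by metis
  show thesis
  proof (rule that, rule uniform_limitI)
    fix e :: real assume "e > 0"
    then have "\<forall>\<^sub>F n in sequentially. inverse (real (Suc n)) < e"
      by (rule order_tendstoD(2)[OF LIMSEQ_inverse_real_of_nat])
    then show "\<forall>\<^sub>F n in sequentially. \<forall>x\<in>{a..b}. dist (poly (p n) x) (f x) < e"
      by eventually_elim (use p less_trans in blast)
  qed
qed

section \<open>Calculus rules for functions continuous on an interval around the spectrum\<close>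

context
  fixes T :: "'a::complex_hilbert_space \<Rightarrow>\<^sub>L 'a" and a b :: real
  assumes T: "T \<in> hermitian_ops" and spec: "real_spectrum T \<subseteq> {a..b}"
begin

lemma fun_calc_approx:
  assumes "continuous_on {a..b} f"
  obtains p where "uniform_limit {a..b} (\<lambda>n. poly (p n)) f sequentially"
    and "(\<lambda>n. poly_op (p n) T) \<longlonglongrightarrow> fun_calc f T"
proof -
  obtain p where p: "uniform_limit {a..b} (\<lambda>n. poly (p n)) f sequentially"
    using assms by (rule uniform_limit_poly)
  show thesis
    by (rule that[OF p]) (intro fun_calc_limit T uniform_limit_on_subset[OF p spec])
qed

lemma fun_calc_cong:
  assumes "\<And>x. x \<in> {a..b} \<Longrightarrow> f x = g x"
  shows "fun_calc f T = fun_calc g T"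
proof -
  have "uniform_limit (real_spectrum T) p f F \<longleftrightarrow> uniform_limit (real_spectrum T) p g F"
    for p :: "nat \<Rightarrow> real \<Rightarrow> real" and F
    using assms spec by (intro uniform_limit_cong') auto
  then show ?thesis
    unfolding fun_calc_def real_spectrum_def[symmetric] by simp
qed

lemma fun_calc_poly: "fun_calc (poly p) T = poly_op p T"
proof -
  have "uniform_limit (real_spectrum T) (\<lambda>n::nat. poly p) (poly p) sequentially"
    by (rule uniform_limit_const)
  from fun_calc_limit[OF T, of "\<lambda>n. p", OF this] show ?thesis
    by (simp add: LIMSEQ_const_iff)
qed

lemma hermitian_fun_calc:
  assumes "continuous_on {a..b} f"
  shows "fun_calc f T \<in> hermitian_ops"
  using fun_calc_approx[OF assms] hermitian_limit[OF hermitian_poly_op[OF T]] by metis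

lemma fun_calc_mult:
  assumes f: "continuous_on {a..b} f" and g: "continuous_on {a..b} g"
  shows "fun_calc (\<lambda>x. f x * g x) T = fun_calc f T o\<^sub>L fun_calc g T"
proof -
  obtain p where p: "uniform_limit {a..b} (\<lambda>n. poly (p n)) f sequentially"
    "(\<lambda>n. poly_op (p n) T) \<longlonglongrightarrow> fun_calc f T"
    using f by (rule fun_calc_approx)
  obtain q where q: "uniform_limit {a..b} (\<lambda>n. poly (q n)) g sequentially"
    "(\<lambda>n. poly_op (q n) T) \<longlonglongrightarrow> fun_calc g T"
    using g by (rule fun_calc_approx)
  \<comment> \<open>Products of uniformly convergent sequences converge uniformly when the limits
    are bounded; here the limits are continuous on a compact interval.\<close>
  have "bounded (f ` {a..b})" "bounded (g ` {a..b})"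
    using f g by (auto intro!: compact_imp_bounded compact_continuous_image)
  with p(1) q(1) have "uniform_limit {a..b} (\<lambda>n. poly (p n * q n)) (\<lambda>x. f x * g x) sequentially"
    unfolding poly_mult[abs_def] by (intro uniform_lim_mult)
  then have "(\<lambda>n. poly_op (p n * q n) T) \<longlonglongrightarrow> fun_calc (\<lambda>x. f x * g x) T"
    by (intro fun_calc_limit T) (rule uniform_limit_on_subset[OF _ spec])
  moreover have "(\<lambda>n. poly_op (p n * q n) T) \<longlonglongrightarrow> (fun_calc f T o\<^sub>L fun_calc g T)"
    unfolding poly_op_mult
    by (rule bounded_bilinear.tendsto[OF bounded_bilinear_blinfun_compose p(2) q(2)])
  ultimately show ?thesis
    by (rule LIMSEQ_unique)
qed

text \<open>The polynomial norm bound passed to the limit. It turns uniform convergence of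
  continuous functions into norm convergence of operators, as the composition rule requires.\<close>

lemma norm_fun_calc_diff_le:
  assumes f: "continuous_on {a..b} f" and g: "continuous_on {a..b} g"
    and e: "0 \<le> e" "\<And>x. x \<in> {a..b} \<Longrightarrow> dist (f x) (g x) \<le> e"
  shows "norm (fun_calc f T - fun_calc g T) \<le> e"
proof (rule field_le_epsilon)
  fix d :: real assume "d > 0"
  then have d: "d / 2 > 0"
    by simp
  obtain p where p: "uniform_limit {a..b} (\<lambda>n. poly (p n)) f sequentially"
    "(\<lambda>n. poly_op (p n) T) \<longlonglongrightarrow> fun_calc f T"
    using f by (rule fun_calc_approx)
  obtain q where q: "uniform_limit {a..b} (\<lambda>n. poly (q n)) g sequentially"
    "(\<lambda>n. poly_op (q n) T) \<longlonglongrightarrow> fun_calc g T"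
    using g by (rule fun_calc_approx)
  from uniform_limitD[OF p(1) d] uniform_limitD[OF q(1) d]
  have "\<forall>\<^sub>F n in sequentially. norm (poly_op (p n) T - poly_op (q n) T) \<le> e + d"
  proof eventually_elim
    case (elim n)
    show ?case
      unfolding poly_op_diff[symmetric]
    proof (rule norm_poly_op_le[OF T])
      fix c assume "c \<in> real_spectrum T"
      then have c: "c \<in> {a..b}"
        using spec by blast
      then have "dist (poly (p n) c) (f c) < d / 2" "dist (poly (q n) c) (g c) < d / 2"
        using elim by blast+
      with e(2)[OF c] show "\<bar>poly (p n - q n) c\<bar> \<le> e + d"
        unfolding dist_real_def poly_diff by linarith
    qed (use e(1) d in simp)
  qed
  then show "norm (fun_calc f T - fun_calc g T) \<le> e + d"
    using tendsto_upperbound[OF tendsto_norm[OF tendsto_diff[OF p(2) q(2)]]] by simp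
qed

lemma fun_calc_add:
  assumes f: "continuous_on {a..b} f" and g: "continuous_on {a..b} g"
  shows "fun_calc (\<lambda>x. f x + g x) T = fun_calc f T + fun_calc g T"
proof -
  obtain p where p: "uniform_limit {a..b} (\<lambda>n. poly (p n)) f sequentially"
    "(\<lambda>n. poly_op (p n) T) \<longlonglongrightarrow> fun_calc f T"
    using f by (rule fun_calc_approx)
  obtain q where q: "uniform_limit {a..b} (\<lambda>n. poly (q n)) g sequentially"
    "(\<lambda>n. poly_op (q n) T) \<longlonglongrightarrow> fun_calc g T"
    using g by (rule fun_calc_approx)
  from p(1) q(1) have "uniform_limit {a..b} (\<lambda>n. poly (p n + q n)) (\<lambda>x. f x + g x) sequentially"
    unfolding poly_add[abs_def] by (rule uniform_limit_add)
  then have "(\<lambda>n. poly_op (p n + q n) T) \<longlonglongrightarrow> fun_calc (\<lambda>x. f x + g x) T"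
    by (intro fun_calc_limit T) (rule uniform_limit_on_subset[OF _ spec])
  moreover have "(\<lambda>n. poly_op (p n + q n) T) \<longlonglongrightarrow> fun_calc f T + fun_calc g T"
    unfolding poly_op_add by (rule tendsto_add[OF p(2) q(2)])
  ultimately show ?thesis
    by (rule LIMSEQ_unique)
qed

text \<open>The composition rule for a polynomial outer function: each Horner step is one use of the
  sum rule and one of the product rule.\<close>

lemma poly_op_fun_calc:
  assumes f: "continuous_on {a..b} f"
  shows "poly_op p (fun_calc f T) = fun_calc (\<lambda>x. poly p (f x)) T"
proof (induction p)
  case 0
  show ?case
    using fun_calc_poly[of 0] by (simp add: poly_0[abs_def])
next
  case (pCons c p)
  have cont: "continuous_on {a..b} (\<lambda>x. poly p (f x))"
    by (intro continuous_intros f)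
  have "fun_calc (\<lambda>x. c) T = c *\<^sub>R id_blinfun"
    using fun_calc_poly[of "[:c:]"] fun_calc_cong[of "\<lambda>x. c" "poly [:c:]"] by (simp add: poly_op_pCons)
  then have "fun_calc (\<lambda>x. c + f x * poly p (f x)) T
      = c *\<^sub>R id_blinfun + (fun_calc f T o\<^sub>L fun_calc (\<lambda>x. poly p (f x)) T)"
    using fun_calc_add[OF continuous_on_const[of _ c] continuous_on_mult[OF f cont]]
    by (simp add: fun_calc_mult[OF f cont])
  then show ?case
    by (simp add: poly_op_pCons pCons.IH)
qed

text \<open>Polynomials p_n approximating g on [c, d] give one sequence p_n(f(T)) with two limits:
  g(f(T)), as [c, d] contains the spectrum of f(T), and (g o f)(T), as it contains the values of f.
  Assuming both inclusions avoids a spectral mapping theorem.\<close>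

lemma fun_calc_fun_calc:
  assumes f: "continuous_on {a..b} f" and g: "continuous_on {c..d} g"
    and image: "f ` {a..b} \<subseteq> {c..d}" and spec': "real_spectrum (fun_calc f T) \<subseteq> {c..d}"
  shows "fun_calc g (fun_calc f T) = fun_calc (\<lambda>x. g (f x)) T"
proof -
  obtain p where p: "uniform_limit {c..d} (\<lambda>n. poly (p n)) g sequentially"
    using g by (rule uniform_limit_poly)
  have "(\<lambda>n. poly_op (p n) (fun_calc f T)) \<longlonglongrightarrow> fun_calc g (fun_calc f T)"
    by (intro fun_calc_limit hermitian_fun_calc f uniform_limit_on_subset[OF p spec'])
  moreover have "(\<lambda>n. poly_op (p n) (fun_calc f T)) \<longlonglongrightarrow> fun_calc (\<lambda>x. g (f x)) T"
    unfolding poly_op_fun_calc[OF f]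
  proof (rule tendstoI)
    fix e :: real assume e: "e > 0"
    then have "e / 2 > 0"
      by simp
    from uniform_limitD[OF p this]
    show "\<forall>\<^sub>F n in sequentially. dist (fun_calc (\<lambda>x. poly (p n) (f x)) T) (fun_calc (\<lambda>x. g (f x)) T) < e"
    proof eventually_elim
      case (elim n)
      have "norm (fun_calc (\<lambda>x. poly (p n) (f x)) T - fun_calc (\<lambda>x. g (f x)) T) \<le> e / 2"
      proof (rule norm_fun_calc_diff_le)
        show "continuous_on {a..b} (\<lambda>x. g (f x))"
          using g f image by (rule continuous_on_compose2)
        show "dist (poly (p n) (f x)) (g (f x)) \<le> e / 2" if "x \<in> {a..b}" for x
          using elim image that by (meson image_subset_iff less_imp_le)
      qed (use e in \<open>auto intro!: continuous_intros f\<close>)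
      with e show ?case
        by (simp add: dist_norm)
    qed
  qed
  ultimately show ?thesis
    by (rule LIMSEQ_unique)
qed

end

section \<open>Powers of positive definite operators\<close>

lemma posdef_hermitian: "T \<in> posdef_ops \<Longrightarrow> T \<in> hermitian_ops"
  by (simp add: posdef_ops_def hermitian_ops_def)

lemma posdef_opsI:
  assumes "T \<in> hermitian_ops" "\<And>x. \<exists>r\<ge>0. cinner x (blinfun_apply T x) = complex_of_real r" "invertible_op T"
  shows "T \<in> posdef_ops"
  using assms unfolding posdef_ops_def hermitian_ops_def positive_op_def
  by (auto simp: nonneg_Reals_def)

text \<open>With e a lower bound for T, the operator T - c is bounded below outside [e, ||T||]: for
  c < 0 by positivity of T in the expanded square, for 0 \<le> c < e and for c > ||T|| by the
  reverse triangle inequality.\<close>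

lemma posdef_spectrum:
  assumes T: "(T :: 'a::complex_hilbert_space \<Rightarrow>\<^sub>L 'a) \<in> posdef_ops"
  obtains a b where "0 < a" "a \<le> b" "real_spectrum T \<subseteq> {a..b}"
proof -
  obtain e where e: "e > 0" "\<And>x. e * norm x \<le> norm (T x)"
    using T by (auto simp: posdef_ops_def elim: invertible_op_bounded_below)
  \<comment> \<open>For real c the operator T - c is self-adjoint, so a lower bound alone makes it
    invertible.\<close>
  have regular: "c \<notin> real_spectrum T"
    if "d > 0" "\<And>x. d * norm x \<le> norm (T x - c *\<^sub>R x)" for c d
  proof -
    have "invertible_op (poly_op [:- c, 1:] T)"
      using that(2)
      by (intro hermitian_invertible[OF hermitian_poly_op[OF posdef_hermitian[OF T]] that(1)])
        (simp add: poly_op_linear blinfun.diff_left blinfun.scaleR_left)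
    then show ?thesis
      by (simp add: not_in_real_spectrum_iff)
  qed
  have "e \<le> c" "c \<le> norm T" if c: "c \<in> real_spectrum T" for c
  proof -
    show "e \<le> c"
    proof (rule ccontr)
      assume "\<not> e \<le> c"
      then have "e > c"
        by simp
      show False
      proof (cases "c < 0")
        case True
        have "- c * norm x \<le> norm (T x - c *\<^sub>R x)" for x
        proof -
          have "cinner x (T x) \<in> \<real>\<^sub>\<ge>\<^sub>0"
            using T by (simp add: posdef_ops_def positive_op_def)
          then have "0 \<le> Re (cinner (T x) x)"
            by (subst cinner_commute) (auto simp: complex_nonneg_Reals_iff)
          then have "0 \<le> (- c) * Re (cinner (T x) x)"
            using True by (intro mult_nonneg_nonneg) auto
          moreover have "(norm (T x + (- c) *\<^sub>R x))\<^sup>2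
              = (norm (T x))\<^sup>2 + 2 * ((- c) * Re (cinner (T x) x)) + (- c * norm x)\<^sup>2"
            unfolding norm_add_squared cinner_scaleR_right by (simp add: power_mult_distrib)
          ultimately have "(- c * norm x)\<^sup>2 \<le> (norm (T x + (- c) *\<^sub>R x))\<^sup>2"
            using zero_le_power2[of "norm (T x)"] by linarith
          then have "- c * norm x \<le> norm (T x + (- c) *\<^sub>R x)"
            by (rule power2_le_imp_le) simp
          then show ?thesis
            by simp
        qed
        with regular[of "- c" c] True c show False
          by simp
      next
        case False
        have "(e - c) * norm x \<le> norm (T x - c *\<^sub>R x)" for x
          using e(2)[of x] norm_triangle_ineq2[of "T x" "c *\<^sub>R x"] False
          by (simp add: algebra_simps)
        with regular[of "e - c" c] \<open>e > c\<close> c show False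
          by simp
      qed
    qed
    show "c \<le> norm T"
    proof (rule ccontr)
      assume *: "\<not> c \<le> norm T"
      then have "c > 0"
        using norm_ge_zero[of T] by linarith
      then have "(c - norm T) * norm x \<le> norm (T x - c *\<^sub>R x)" for x
        using norm_blinfun[of T x] norm_triangle_ineq2[of "c *\<^sub>R x" "T x"]
        by (simp add: algebra_simps norm_minus_commute)
      with regular[of "c - norm T" c] * c show False
        by simp
    qed
  qed
  \<comment> \<open>The maximum keeps the interval nonempty on the zero space too, where ||T|| = 0 <
    e.\<close>
  then have "real_spectrum T \<subseteq> {e..max e (norm T)}"
    by (auto simp: le_max_iff_disj)
  with that[of e "max e (norm T)"] e(1) show thesis
    by simp
qed

text \<open>Positivity holds because f(T) is the square of the self-adjoint operator obtained from
  \<open>sqrt (f x)\<close>; invertibility because the function 1/f, continuous on the interval,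
  yields the inverse.\<close>

lemma posdef_fun_calc:
  assumes T: "T \<in> posdef_ops" and spec: "real_spectrum T \<subseteq> {a..b}"
    and f: "continuous_on {a..b} f" "\<And>x. x \<in> {a..b} \<Longrightarrow> f x > 0"
  shows "fun_calc f T \<in> posdef_ops"
proof (rule posdef_opsI)
  note calc = posdef_hermitian[OF T] spec
  let ?R = "fun_calc (\<lambda>x. sqrt (f x)) T"
  have cont_sqrt: "continuous_on {a..b} (\<lambda>x. sqrt (f x))"
    by (intro continuous_intros f(1))
  have cont_inv: "continuous_on {a..b} (\<lambda>x. inverse (f x))"
    using f by (intro continuous_intros) force+
  show "fun_calc f T \<in> hermitian_ops"
    by (rule hermitian_fun_calc[OF calc f(1)])
  have "fun_calc f T = fun_calc (\<lambda>x. sqrt (f x) * sqrt (f x)) T"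
    using f(2) by (intro fun_calc_cong[OF calc]) (simp add: less_imp_le)
  then have "fun_calc f T = ?R o\<^sub>L ?R"
    by (simp only: fun_calc_mult[OF calc cont_sqrt cont_sqrt])
  then have "cinner x (fun_calc f T x) = of_real ((norm (?R x))\<^sup>2)" for x
    using hermitian_apply[OF hermitian_fun_calc[OF calc cont_sqrt], of x "?R x"]
    by (simp add: cinner_self)
  then show "\<exists>r\<ge>0. cinner x (fun_calc f T x) = complex_of_real r" for x
    by (metis zero_le_power2)
  have one: "fun_calc g T = id_blinfun" if "\<And>x. x \<in> {a..b} \<Longrightarrow> g x = 1" for g
    using fun_calc_cong[OF calc, of g "poly 1"] that fun_calc_poly[OF calc, of 1]
    by (simp add: one_pCons poly_op_pCons)
  have "fun_calc f T o\<^sub>L fun_calc (\<lambda>x. inverse (f x)) T = id_blinfun"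
    "fun_calc (\<lambda>x. inverse (f x)) T o\<^sub>L fun_calc f T = id_blinfun"
    using f(2) by (force simp flip: fun_calc_mult[OF calc f(1) cont_inv] fun_calc_mult[OF calc cont_inv f(1)]
        intro!: one)+
  moreover have "fun_calc (\<lambda>x. inverse (f x)) T \<in> bounded_ops"
    using hermitian_fun_calc[OF calc cont_inv] by (simp add: hermitian_ops_def)
  ultimately show "invertible_op (fun_calc f T)"
    unfolding invertible_op_def is_inverse_op_def by blast
qed

section \<open>Power laws and the order-preserving congruences\<close>

lemma continuous_on_powr_Icc: "0 < (a::real) \<Longrightarrow> continuous_on {a..b} (\<lambda>x. x powr t)"
  by (intro continuous_intros) auto

lemma posdef_powr_op:
  assumes "T \<in> posdef_ops"
  shows "powr_op T t \<in> posdef_ops"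
proof -
  obtain a b where "0 < a" "real_spectrum T \<subseteq> {a..b}"
    using assms by (rule posdef_spectrum)
  with assms show ?thesis
    unfolding powr_op_def by (intro posdef_fun_calc[where a = a and b = b] continuous_on_powr_Icc) auto
qed

lemma powr_op_add:
  assumes "T \<in> posdef_ops"
  shows "powr_op T s o\<^sub>L powr_op T t = powr_op T (s + t)"
proof -
  obtain a b where "0 < a" "real_spectrum T \<subseteq> {a..b}"
    using assms by (rule posdef_spectrum)
  then show ?thesis
    unfolding powr_op_def powr_add
    by (intro fun_calc_mult[symmetric] posdef_hermitian assms continuous_on_powr_Icc)
qed

lemma powr_op_0:
  assumes "T \<in> posdef_ops"
  shows "powr_op T 0 = id_blinfun"
proof -
  obtain a b where ab: "0 < a" "real_spectrum T \<subseteq> {a..b}"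
    using assms by (rule posdef_spectrum)
  note calc = posdef_hermitian[OF assms] ab(2)
  \<comment> \<open>Since \<open>0 powr 0 = 0\<close>, agreement with the constant 1 relies on the
    interval staying away from 0.\<close>
  have "powr_op T 0 = fun_calc (poly 1) T"
    unfolding powr_op_def using ab(1) by (intro fun_calc_cong[OF calc]) auto
  then show ?thesis
    by (simp add: fun_calc_poly[OF calc] one_pCons poly_op_pCons)
qed

lemma powr_op_1:
  assumes "T \<in> posdef_ops"
  shows "powr_op T 1 = T"
proof -
  obtain a b where ab: "0 < a" "real_spectrum T \<subseteq> {a..b}"
    using assms by (rule posdef_spectrum)
  note calc = posdef_hermitian[OF assms] ab(2)
  have "powr_op T 1 = fun_calc (poly [:0, 1:]) T"
    unfolding powr_op_def using ab(1) by (intro fun_calc_cong[OF calc]) auto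
  then show ?thesis
    by (simp add: fun_calc_poly[OF calc] poly_op_linear)
qed

text \<open>The composition rule needs one interval in (0, \<infinity>) containing both the image of
  [a, b] under the inner power and the spectrum of \<open>powr_op T s\<close>. The image is an
  interval [c, d] whose left end is attained, hence positive, and the hull of it with [a', b']
  serves.\<close>

lemma powr_op_powr_op:
  assumes T: "T \<in> posdef_ops"
  shows "powr_op (powr_op T s) t = powr_op T (s * t)"
proof -
  obtain a b where ab: "0 < a" "a \<le> b" "real_spectrum T \<subseteq> {a..b}"
    using T by (rule posdef_spectrum)
  obtain a' b' where ab': "0 < a'" "a' \<le> b'" "real_spectrum (powr_op T s) \<subseteq> {a'..b'}"
    using posdef_powr_op[OF T] by (rule posdef_spectrum)
  obtain c d where cd: "(\<lambda>x. x powr s) ` {a..b} = {c..d}" "c \<le> d"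
    using continuous_image_closed_interval[OF ab(2) continuous_on_powr_Icc[OF ab(1)]] by metis
  then have "c \<in> (\<lambda>x. x powr s) ` {a..b}"
    by simp
  then have "c > 0"
    using ab(1) by auto
  with ab'(1) have "continuous_on {min a' c..max b' d} (\<lambda>x. x powr t)"
    by (intro continuous_on_powr_Icc) simp
  moreover have "(\<lambda>x. x powr s) ` {a..b} \<subseteq> {min a' c..max b' d}"
    unfolding cd by auto
  moreover have "real_spectrum (powr_op T s) \<subseteq> {min a' c..max b' d}"
    using ab'(3) by force
  ultimately show ?thesis
    using fun_calc_fun_calc[OF posdef_hermitian[OF T] ab(3) continuous_on_powr_Icc[OF ab(1), of b s],
        where g = "\<lambda>x. x powr t"]
    unfolding powr_op_def by (simp add: powr_powr)
qed

lemma inv_op_posdef: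
  assumes "T \<in> posdef_ops"
  shows "inv_op T = powr_op T (- 1)"
proof (rule inv_op_eqI)
  have "T o\<^sub>L powr_op T (- 1) = powr_op T 1 o\<^sub>L powr_op T (- 1)"
    "powr_op T (- 1) o\<^sub>L T = powr_op T (- 1) o\<^sub>L powr_op T 1"
    by (simp_all add: powr_op_1 assms)
  then show "is_inverse_op T (powr_op T (- 1))"
    using posdef_powr_op[OF assms, of "-1"]
    by (simp add: is_inverse_op_def powr_op_add[OF assms] powr_op_0[OF assms] posdef_ops_def)
qed

lemma posdef_inv_op: "T \<in> posdef_ops \<Longrightarrow> inv_op T \<in> posdef_ops"
  by (simp add: inv_op_posdef posdef_powr_op)

lemma posdef_congruence:
  assumes S: "S \<in> posdef_ops" and T: "T \<in> posdef_ops"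
  shows "S o\<^sub>L T o\<^sub>L S \<in> posdef_ops"
proof -
  have "cinner x (S (T (S x))) = cinner (S x) (T (S x))" for x
    using hermitian_apply[OF posdef_hermitian[OF S]] by simp
  then have "positive_op (S o\<^sub>L T o\<^sub>L S)"
    using T by (simp add: posdef_ops_def positive_op_def)
  moreover have "invertible_op (S o\<^sub>L T o\<^sub>L S)"
    using S T by (simp add: posdef_ops_def invertible_op_compose)
  ultimately show ?thesis
    using hermitian_congruence[OF posdef_hermitian[OF S] posdef_hermitian[OF T]]
    by (simp add: posdef_ops_def hermitian_ops_def)
qed

section \<open>The Riccati equation\<close>

text \<open>The second form cancels inside right-nested products, the normal form produced by
  \<open>compose_assoc\<close>.\<close>

lemma powr_op_cancel:
  assumes "T \<in> posdef_ops" "s + t = 0"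
  shows "powr_op T s o\<^sub>L powr_op T t = id_blinfun" "powr_op T s o\<^sub>L (powr_op T t o\<^sub>L R) = R"
proof -
  show "powr_op T s o\<^sub>L powr_op T t = id_blinfun"
    using assms by (simp add: powr_op_add powr_op_0)
  then show "powr_op T s o\<^sub>L (powr_op T t o\<^sub>L R) = R"
    by (simp flip: compose_assoc)
qed

text \<open>Existence and uniqueness of the positive definite square root, both read off from the
  power laws.\<close>

lemma powr_op_half_square:
  assumes "T \<in> posdef_ops"
  shows "powr_op T (1/2) o\<^sub>L powr_op T (1/2) = T"
    "powr_op (T o\<^sub>L T) (1/2) = T"
proof -
  show "powr_op T (1/2) o\<^sub>L powr_op T (1/2) = T"
    using assms by (simp add: powr_op_add powr_op_1)
  have "T o\<^sub>L T = powr_op T 2"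
    using powr_op_add[OF assms, of 1 1] by (simp add: powr_op_1 assms)
  then show "powr_op (T o\<^sub>L T) (1/2) = T"
    by (simp add: powr_op_powr_op powr_op_1 assms)
qed

lemma posdef_geom_mean:
  assumes "C \<in> posdef_ops" "X \<in> posdef_ops"
  shows "geom_mean C X \<in> posdef_ops"
  unfolding geom_mean_def by (intro posdef_congruence posdef_powr_op assms)

text \<open>Powers of the inverse are negated powers of A, so the mean is P W P with P = A^(-1/2), Q
  = A^(1/2) and W^2 = Q X Q. Writing A = Q Q, the product telescopes to P W^2 P = X.\<close>

lemma geom_mean_riccati:
  assumes A: "A \<in> posdef_ops" and X: "X \<in> posdef_ops"
  shows "geom_mean (inv_op A) X o\<^sub>L A o\<^sub>L geom_mean (inv_op A) X = X"
proof -
  define P where "P = powr_op A (- 1/2)"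
  define Q where "Q = powr_op A (1/2)"
  define W where "W = powr_op (Q o\<^sub>L X o\<^sub>L Q) (1/2)"
  have gm: "geom_mean (inv_op A) X = P o\<^sub>L W o\<^sub>L P"
    by (simp add: geom_mean_def inv_op_posdef A powr_op_powr_op P_def Q_def W_def)
  have A_eq: "A = Q o\<^sub>L Q"
    using powr_op_half_square(1)[OF A] by (simp add: Q_def)
  have PQ: "P o\<^sub>L Q = id_blinfun" "Q o\<^sub>L P = id_blinfun"
    "P o\<^sub>L (Q o\<^sub>L R) = R" "Q o\<^sub>L (P o\<^sub>L R) = R" for R
    by (simp_all add: P_def Q_def powr_op_cancel A)
  have WW: "W o\<^sub>L W = Q o\<^sub>L X o\<^sub>L Q"
    unfolding W_def Q_def by (intro powr_op_half_square posdef_congruence posdef_powr_op A X)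
  have "(P o\<^sub>L W o\<^sub>L P) o\<^sub>L A o\<^sub>L (P o\<^sub>L W o\<^sub>L P) = P o\<^sub>L (W o\<^sub>L W) o\<^sub>L P"
    by (simp add: A_eq compose_assoc PQ)
  also have "\<dots> = X"
    by (simp add: WW compose_assoc PQ)
  finally show ?thesis
    by (simp only: gm)
qed

text \<open>For X = Y A Y the inner operator Q X Q is the square of the positive definite Q Y Q. Its
  root is therefore Q Y Q, and the outer factors P remove Q.\<close>

lemma geom_mean_riccati_unique:
  assumes A: "A \<in> posdef_ops" and Y: "Y \<in> posdef_ops"
  shows "geom_mean (inv_op A) (Y o\<^sub>L A o\<^sub>L Y) = Y"
proof -
  define P where "P = powr_op A (- 1/2)"
  define Q where "Q = powr_op A (1/2)"
  have gm: "geom_mean (inv_op A) X = P o\<^sub>L powr_op (Q o\<^sub>L X o\<^sub>L Q) (1/2) o\<^sub>L P" for X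
    by (simp add: geom_mean_def inv_op_posdef A powr_op_powr_op P_def Q_def)
  have A_eq: "A = Q o\<^sub>L Q"
    using powr_op_half_square(1)[OF A] by (simp add: Q_def)
  have PQ: "Q o\<^sub>L P = id_blinfun" "P o\<^sub>L (Q o\<^sub>L R) = R" for R
    by (simp_all add: P_def Q_def powr_op_cancel A)
  have "Q o\<^sub>L (Y o\<^sub>L A o\<^sub>L Y) o\<^sub>L Q = (Q o\<^sub>L Y o\<^sub>L Q) o\<^sub>L (Q o\<^sub>L Y o\<^sub>L Q)"
    by (simp add: A_eq compose_assoc)
  then have "powr_op (Q o\<^sub>L (Y o\<^sub>L A o\<^sub>L Y) o\<^sub>L Q) (1/2) = Q o\<^sub>L Y o\<^sub>L Q"
    unfolding Q_def using powr_op_half_square(2)[OF posdef_congruence[OF posdef_powr_op[OF A] Y]] by simp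
  then show ?thesis
    by (simp add: gm compose_assoc PQ)
qed

section \<open>Bijections of the positive definite cone\<close>

lemma bij_betw_congruence:
  assumes "A \<in> posdef_ops"
  shows "bij_betw (\<lambda>Y. Y o\<^sub>L A o\<^sub>L Y) posdef_ops posdef_ops"
  by (rule bij_betw_byWitness[where f' = "geom_mean (inv_op A)"])
    (auto simp: geom_mean_riccati geom_mean_riccati_unique assms
      intro: posdef_congruence posdef_geom_mean posdef_inv_op assms)

lemma bij_betw_geom_mean_right:
  assumes "A \<in> posdef_ops"
  shows "bij_betw (\<lambda>X. geom_mean (inv_op A) X) posdef_ops posdef_ops"
  by (rule bij_betw_byWitness[where f' = "\<lambda>Y. Y o\<^sub>L A o\<^sub>L Y"])
    (auto simp: geom_mean_riccati geom_mean_riccati_unique assms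
      intro: posdef_congruence posdef_geom_mean posdef_inv_op assms)

lemma bij_betw_powr_op:
  assumes "t \<noteq> 0"
  shows "bij_betw (\<lambda>X. powr_op X t) posdef_ops posdef_ops"
  by (rule bij_betw_byWitness[where f' = "\<lambda>X. powr_op X (1 / t)"])
    (auto simp: powr_op_powr_op powr_op_1 assms posdef_powr_op)

lemma sandwich_inverse:
  assumes "Y \<in> posdef_ops"
  shows "inv_op Y o\<^sub>L (Y o\<^sub>L X o\<^sub>L Y) o\<^sub>L inv_op Y = X"
    "Y o\<^sub>L (inv_op Y o\<^sub>L X o\<^sub>L inv_op Y) o\<^sub>L Y = X"
proof -
  have cancel: "inv_op Y o\<^sub>L Y = id_blinfun" "Y o\<^sub>L inv_op Y = id_blinfun"
    "inv_op Y o\<^sub>L (Y o\<^sub>L R) = R" "Y o\<^sub>L (inv_op Y o\<^sub>L R) = R" for R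
    using powr_op_cancel[of Y 1 "-1"] powr_op_cancel[of Y "-1" 1] assms
    by (simp_all add: inv_op_posdef powr_op_1)
  show "inv_op Y o\<^sub>L (Y o\<^sub>L X o\<^sub>L Y) o\<^sub>L inv_op Y = X"
    "Y o\<^sub>L (inv_op Y o\<^sub>L X o\<^sub>L inv_op Y) o\<^sub>L Y = X"
    by (simp_all add: compose_assoc cancel)
qed

text \<open>The Riccati equation Y X Y = B is solved for X instead of Y, so the inverse map is a
  congruence of B by the inverse of Y. Uniqueness of its positive definite solution gives the other
  direction.\<close>

lemma bij_betw_geom_mean_left:
  assumes B: "B \<in> posdef_ops"
  shows "bij_betw (\<lambda>X. geom_mean (inv_op X) B) posdef_ops posdef_ops"
proof (rule bij_betw_byWitness[where f' = "\<lambda>Y. inv_op Y o\<^sub>L B o\<^sub>L inv_op Y"])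
  show "(\<lambda>X. geom_mean (inv_op X) B) ` posdef_ops \<subseteq> posdef_ops"
    by (auto intro: posdef_geom_mean posdef_inv_op B)
  show "(\<lambda>Y. inv_op Y o\<^sub>L B o\<^sub>L inv_op Y) ` posdef_ops \<subseteq> posdef_ops"
    by (auto intro: posdef_congruence posdef_inv_op B)
  show "\<forall>X\<in>posdef_ops. inv_op (geom_mean (inv_op X) B) o\<^sub>L B o\<^sub>L inv_op (geom_mean (inv_op X) B) = X"
  proof
    fix X :: "'a \<Rightarrow>\<^sub>L 'a" assume X: "X \<in> posdef_ops"
    then show "inv_op (geom_mean (inv_op X) B) o\<^sub>L B o\<^sub>L inv_op (geom_mean (inv_op X) B) = X"
      using sandwich_inverse(1)[OF posdef_geom_mean[OF posdef_inv_op[OF X] B], of X]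
      by (simp add: geom_mean_riccati B)
  qed
  show "\<forall>Y\<in>posdef_ops. geom_mean (inv_op (inv_op Y o\<^sub>L B o\<^sub>L inv_op Y)) B = Y"
  proof
    fix Y :: "'a \<Rightarrow>\<^sub>L 'a" assume Y: "Y \<in> posdef_ops"
    show "geom_mean (inv_op (inv_op Y o\<^sub>L B o\<^sub>L inv_op Y)) B = Y"
      using geom_mean_riccati_unique[OF posdef_congruence[OF posdef_inv_op[OF Y] B] Y]
      by (simp add: sandwich_inverse(2) Y)
  qed
qed

lemma bij_betw_spectral_geom_mean_right:
  assumes A: "A \<in> posdef_ops" and t: "t \<noteq> 0"
  shows "bij_betw (\<lambda>X. spectral_geom_mean t A X) posdef_ops posdef_ops"
  using bij_betw_trans[OF bij_betw_trans[OF bij_betw_geom_mean_right[OF A] bij_betw_powr_op[OF t]]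
      bij_betw_congruence[OF A]]
  by (simp add: spectral_geom_mean_def o_def)

text \<open>Substituting B = Y X Y removes the explicit X, so that the variable enters only through
  Y; each side of B then gives up one power of Y.\<close>

lemma spectral_geom_mean_altdef:
  assumes X: "X \<in> posdef_ops" and B: "B \<in> posdef_ops"
  defines "Y \<equiv> geom_mean (inv_op X) B"
  shows "spectral_geom_mean t X B = powr_op Y (t - 1) o\<^sub>L B o\<^sub>L powr_op Y (t - 1)"
proof -
  have Y: "Y \<in> posdef_ops"
    unfolding Y_def by (intro posdef_geom_mean posdef_inv_op X B)
  have "powr_op Y (t - 1) o\<^sub>L Y = powr_op Y t" "Y o\<^sub>L powr_op Y (t - 1) = powr_op Y t"
    using powr_op_add[OF Y, of "t - 1" 1] powr_op_add[OF Y, of 1 "t - 1"]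
    by (simp_all add: powr_op_1 Y)
  moreover have "B = Y o\<^sub>L X o\<^sub>L Y"
    by (simp add: Y_def geom_mean_riccati X B)
  ultimately have "powr_op Y (t - 1) o\<^sub>L B o\<^sub>L powr_op Y (t - 1) = powr_op Y t o\<^sub>L X o\<^sub>L powr_op Y t"
    by (metis compose_assoc)
  then show ?thesis
    by (simp add: spectral_geom_mean_def Y_def)
qed

text \<open>In the alternative form the map is the composite X |-> Y |-> Z = Y^(t-1) |-> Z B Z. The
  condition \<open>t \<noteq> 1\<close> makes the exponent nonzero, hence the power map
  bijective.\<close>

lemma bij_betw_spectral_geom_mean_left:
  assumes B: "B \<in> posdef_ops" and t: "t \<noteq> 1"
  shows "bij_betw (\<lambda>X. spectral_geom_mean t X B) posdef_ops posdef_ops"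
proof -
  have "bij_betw (\<lambda>X. powr_op (geom_mean (inv_op X) B) (t - 1) o\<^sub>L B o\<^sub>L
      powr_op (geom_mean (inv_op X) B) (t - 1)) posdef_ops posdef_ops"
    using bij_betw_trans[OF bij_betw_trans[OF bij_betw_geom_mean_left[OF B] bij_betw_powr_op[of "t - 1"]]
        bij_betw_congruence[OF B]] t
    by (simp add: o_def)
  then show ?thesis
    by (rule bij_betw_cong[THEN iffD1, rotated]) (simp add: spectral_geom_mean_altdef B)
qed

theorem theorem2p5:
  fixes A B :: "'a::complex_hilbert_space \<Rightarrow>\<^sub>L 'a"
  assumes "A \<in> posdef_ops" and "B \<in> posdef_ops"
  shows "(\<forall>t::real. 0 < t \<and> t \<le> 1 \<longrightarrow>
            bij_betw (\<lambda>X. spectral_geom_mean t A X) posdef_ops posdef_ops) \<and>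
         (\<forall>t::real. 0 \<le> t \<and> t < 1 \<longrightarrow>
            bij_betw (\<lambda>X. spectral_geom_mean t X B) posdef_ops posdef_ops)"
  using assms by (simp add: bij_betw_spectral_geom_mean_right bij_betw_spectral_geom_mean_left)

end
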